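(* Let $S\subseteq\mathbb{N}$ be a finite set with $|S|=k\geq 1$. Then $z_S\leq \frac{2}{\pi}\sqrt{k-1}$. Moreover, if $k\geq 2$, then $z_S\leq \frac14+\frac{2}{\pi}\left(\sqrt{k-1}-1\right)$, and this is at most $\frac{2}{\pi}\sqrt{k-1}$.
   Context: $\mathbb{N}=\{0,1,2,\dots\}$. For a finite nonempty set $S=\{e_1,\dots,e_k\}\subseteq\mathbb{N}$ (distinct elements), let $f_S(x)=\sum_{i=1}^k a_i x^{e_i}$, where $a_1,\dots,a_k$ are independent standard normal random variables. For an open interval $I\subseteq(0,\infty)$, $z_S^I$ denotes the expected number of zeros of $f_S$ in $I$, and $z_S:=z_S^{(0,1)}$. *)

theory Defs
  imports "HOL-Probability.Probability"
begin

definition rand_poly :: "nat set \<Rightarrow> (nat \<Rightarrow> real) \<Rightarrow> real \<Rightarrow> real" where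
  "rand_poly S a x = (\<Sum>e\<in>S. a e * x ^ e)"

text \<open>Number of zeros of f_S (for coefficient vector a) in I. If the zero set is
  infinite (only when all coefficients vanish, a null event) card gives 0.\<close>
definition num_zeros :: "nat set \<Rightarrow> real set \<Rightarrow> (nat \<Rightarrow> real) \<Rightarrow> nat" where
  "num_zeros S I a = card {x \<in> I. rand_poly S a x = 0}"

definition coeff_measure :: "nat set \<Rightarrow> (nat \<Rightarrow> real) measure" where
  "coeff_measure S = (\<Pi>\<^sub>M e\<in>S. density lborel std_normal_density)"

definition expected_zeros :: "nat set \<Rightarrow> real set \<Rightarrow> ennreal" where
  "expected_zeros S I = (\<integral>\<^sup>+ a. of_nat (num_zeros S I a) \<partial>coeff_measure S)"

definition z :: "nat set \<Rightarrow> ennreal" where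
  "z S = expected_zeros S {0<..<1}"

end

theory Submission
  imports Defs
begin

text \<open>
  Almost surely \<open>f\<^sub>S\<close> has no double zero, so its number of zeros in \<open>(0, 1)\<close> is at most the limit
  inferior of its number of sign changes along the grids \<open>i / n\<close>. The probability of a sign change
  between \<open>x\<close> and \<open>y\<close> is \<open>1 / \<pi>\<close> times the angle between the vectors \<open>(x ^ e)\<close> and \<open>(y ^ e)\<close>,
  \<open>e \<in> S\<close>, so by Fatou's lemma it suffices to bound the sum of these angles along a grid.

  Write \<open>S\<close> as \<open>S'\<close> together with its largest element \<open>m\<close>. The unit vector in the direction
  \<open>(x ^ e)\<close>, \<open>e \<in> S\<close>, is obtained from the one for \<open>S'\<close> by tilting it by an angle \<open>\<theta>(x)\<close> towards
  the new axis, and \<open>\<theta>\<close> increases with \<open>x\<close> because \<open>m\<close> is maximal. By the spherical triangle inequality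
  the angle sum for \<open>S\<close> exceeds the one for \<open>S'\<close> by at most \<open>\<theta>(1) = arctan (1 / \<surd>|S'|)\<close>. This is
  \<open>\<pi> / 4\<close> if \<open>|S'| = 1\<close>, and in general at most \<open>1 / \<surd>j \<le> 2 * (\<surd>j - \<surd>(j - 1))\<close> with \<open>j = |S'|\<close>,
  which telescopes.
\<close>

section \<open>Linear forms in independent normal variables\<close>

abbreviation std_normal :: "real measure" where
  "std_normal \<equiv> density lborel std_normal_density"

interpretation std_normal: prob_space std_normal
  by (rule prob_space_normal_density) simp

lemma emeasure_std_normal_UNIV [simp]: "emeasure std_normal UNIV = 1"
  using std_normal.emeasure_space_1 by simp

interpretation std_normal_pair: pair_sigma_finite std_normal std_normal ..

lemma nn_integral_std_normal:
  assumes [measurable]: "f \<in> borel_measurable borel"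
  shows "(\<integral>\<^sup>+x. f x \<partial>std_normal) = (\<integral>\<^sup>+x. ennreal (std_normal_density x) * f x \<partial>lborel)"
  by (subst nn_integral_density) auto

lemma nn_integral_std_normal_pair:
  assumes [measurable]: "f \<in> borel_measurable (borel \<Otimes>\<^sub>M borel)"
  shows "(\<integral>\<^sup>+x. \<integral>\<^sup>+y. f (x, y) \<partial>std_normal \<partial>std_normal) =
    (\<integral>\<^sup>+x. \<integral>\<^sup>+y. ennreal (std_normal_density x * std_normal_density y) * f (x, y) \<partial>lborel \<partial>lborel)"
proof -
  have "(\<integral>\<^sup>+y. f (x, y) \<partial>std_normal) =
      (\<integral>\<^sup>+y. ennreal (std_normal_density y) * f (x, y) \<partial>lborel)" for x
    by (rule nn_integral_std_normal) measurable
  then show ?thesis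
    by (simp add: nn_integral_std_normal nn_integral_cmult[symmetric] ennreal_mult mult.assoc)
qed

text \<open>A rotation with \<open>c \<noteq> 0\<close> is the composite of two affine
  substitutions, each changing one variable while the other is fixed. Their Jacobians
  \<open>1 / \<bar>c\<bar>\<close> and \<open>\<bar>c\<bar>\<close> cancel. For \<open>c = 0\<close>
  the rotation is a swap of coordinates up to signs.\<close>

lemma nn_integral_lborel_rotate:
  fixes c s :: real
  assumes [measurable]: "f \<in> borel_measurable (borel \<Otimes>\<^sub>M borel)" and cs: "c\<^sup>2 + s\<^sup>2 = 1"
  shows "(\<integral>\<^sup>+x. \<integral>\<^sup>+y. f (c * x + s * y, c * y - s * x) \<partial>lborel \<partial>lborel) =
    (\<integral>\<^sup>+x. \<integral>\<^sup>+y. f (x, y) \<partial>lborel \<partial>lborel)"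
proof (cases "c = 0")
  case True
  then have s: "s \<noteq> 0" "\<bar>s\<bar> = 1" using cs by (auto simp: abs_square_eq_1)
  have "(\<integral>\<^sup>+x. \<integral>\<^sup>+y. f (s * y, - (s * x)) \<partial>lborel \<partial>lborel) =
      (\<integral>\<^sup>+x. \<integral>\<^sup>+y. f (y, - (s * x)) \<partial>lborel \<partial>lborel)"
    using nn_integral_real_affine[of "\<lambda>y. f (y, - (s * x))" s 0 for x] s by simp
  also have "\<dots> = (\<integral>\<^sup>+x. \<integral>\<^sup>+y. f (y, x) \<partial>lborel \<partial>lborel)"
    using nn_integral_real_affine[of "\<lambda>x. \<integral>\<^sup>+y. f (y, x) \<partial>lborel" "-s" 0] s by simp
  also have "\<dots> = (\<integral>\<^sup>+x. \<integral>\<^sup>+y. f (x, y) \<partial>lborel \<partial>lborel)"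
    by (rule lborel_pair.Fubini') measurable
  finally show ?thesis using True by simp
next
  case False
  \<comment> \<open>The two substitutions, performed one after the other, yield the second
    coordinate of the rotated point.\<close>
  have inv: "- (s / c) * (s * y + c * x) + 1 / c * y = c * y - s * x" for x y
  proof -
    have "- (s / c) * (s * y + c * x) + 1 / c * y = (1 - s\<^sup>2) / c * y - s * x"
      using False by (simp add: field_simps power2_eq_square)
    also have "1 - s\<^sup>2 = c * c" using cs by (simp add: power2_eq_square)
    finally show ?thesis using False by simp
  qed
  have "(\<integral>\<^sup>+x. \<integral>\<^sup>+y. f (x, y) \<partial>lborel \<partial>lborel) =
      (\<integral>\<^sup>+x. ennreal \<bar>1 / c\<bar> * (\<integral>\<^sup>+y. f (x, - (s / c) * x + 1 / c * y) \<partial>lborel) \<partial>lborel)"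
    by (intro nn_integral_cong nn_integral_real_affine) (use False in auto)
  also have "\<dots> = ennreal \<bar>1 / c\<bar> * (\<integral>\<^sup>+x. \<integral>\<^sup>+y. f (x, - (s / c) * x + 1 / c * y) \<partial>lborel \<partial>lborel)"
    by (rule nn_integral_cmult) measurable
  also have "(\<integral>\<^sup>+x. \<integral>\<^sup>+y. f (x, - (s / c) * x + 1 / c * y) \<partial>lborel \<partial>lborel) =
      (\<integral>\<^sup>+y. \<integral>\<^sup>+x. f (x, - (s / c) * x + 1 / c * y) \<partial>lborel \<partial>lborel)"
    by (rule lborel_pair.Fubini'[symmetric]) measurable
  also have "\<dots> = (\<integral>\<^sup>+y. ennreal \<bar>c\<bar> * (\<integral>\<^sup>+x. f (s * y + c * x, - (s / c) * (s * y + c * x) + 1 / c * y) \<partial>lborel) \<partial>lborel)"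
    by (intro nn_integral_cong nn_integral_real_affine) (use False in auto)
  also have "\<dots> = ennreal \<bar>c\<bar> * (\<integral>\<^sup>+y. \<integral>\<^sup>+x. f (s * y + c * x, - (s / c) * (s * y + c * x) + 1 / c * y) \<partial>lborel \<partial>lborel)"
    by (rule nn_integral_cmult) measurable
  also have "(\<integral>\<^sup>+y. \<integral>\<^sup>+x. f (s * y + c * x, - (s / c) * (s * y + c * x) + 1 / c * y) \<partial>lborel \<partial>lborel) =
      (\<integral>\<^sup>+y. \<integral>\<^sup>+x. f (s * y + c * x, c * y - s * x) \<partial>lborel \<partial>lborel)"
    unfolding inv ..
  also have "\<dots> =
      (\<integral>\<^sup>+x. \<integral>\<^sup>+y. f (s * y + c * x, c * y - s * x) \<partial>lborel \<partial>lborel)"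
    by (rule lborel_pair.Fubini') measurable
  finally show ?thesis
    using False by (simp add: mult.assoc[symmetric] ennreal_mult[symmetric] add.commute)
qed

text \<open>The product of the two densities depends only on the sum of the squares of the
  coordinates, so the invariance of Lebesgue measure carries over.\<close>

lemma nn_integral_std_normal_rotate:
  fixes c s :: real
  assumes [measurable]: "f \<in> borel_measurable (borel \<Otimes>\<^sub>M borel)" and cs: "c\<^sup>2 + s\<^sup>2 = 1"
  shows "(\<integral>\<^sup>+x. \<integral>\<^sup>+y. f (c * x + s * y, c * y - s * x) \<partial>std_normal \<partial>std_normal) =
    (\<integral>\<^sup>+x. \<integral>\<^sup>+y. f (x, y) \<partial>std_normal \<partial>std_normal)"
proof -
  define g where "g p = ennreal (std_normal_density (fst p) * std_normal_density (snd p)) * f p" for p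
  have g [measurable]: "g \<in> borel_measurable (borel \<Otimes>\<^sub>M borel)"
    unfolding g_def by measurable
  have "std_normal_density (c * x + s * y) * std_normal_density (c * y - s * x) =
      std_normal_density x * std_normal_density y" for x y
  proof -
    have "(c * x + s * y)\<^sup>2 + (c * y - s * x)\<^sup>2 = (c\<^sup>2 + s\<^sup>2) * (x\<^sup>2 + y\<^sup>2)"
      by (simp add: power2_eq_square algebra_simps)
    then have "(c * x + s * y)\<^sup>2 + (c * y - s * x)\<^sup>2 = x\<^sup>2 + y\<^sup>2" using cs by simp
    then have "- (c * x + s * y)\<^sup>2 / 2 + - (c * y - s * x)\<^sup>2 / 2 = - x\<^sup>2 / 2 + - y\<^sup>2 / 2"
      by (simp add: field_simps)
    then show ?thesis
      unfolding std_normal_density_def by (simp add: exp_add[symmetric] del: exp_add)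
  qed
  then have "g (c * x + s * y, c * y - s * x) =
      ennreal (std_normal_density x * std_normal_density y) * f (c * x + s * y, c * y - s * x)" for x y
    by (simp add: g_def)
  then show ?thesis
    using nn_integral_lborel_rotate[OF g cs]
      nn_integral_std_normal_pair[of "\<lambda>p. f (c * fst p + s * snd p, c * snd p - s * fst p)"]
      nn_integral_std_normal_pair[of f]
    by (simp add: g_def)
qed

text \<open>The equations are free of division, so the zero vector is allowed (with the identity
  rotation) and degenerate linear forms need no separate treatment later.\<close>

lemma rotation_exists:
  fixes a b :: real
  obtains c s where "c\<^sup>2 + s\<^sup>2 = 1" "sqrt (a\<^sup>2 + b\<^sup>2) * c = a" "sqrt (a\<^sup>2 + b\<^sup>2) * s = b"
proof (cases "a = 0 \<and> b = 0")
  case True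
  then show ?thesis using that[of 1 0] by simp
next
  case False
  then have "a\<^sup>2 + b\<^sup>2 > 0" by (simp add: sum_power2_gt_zero_iff)
  then show ?thesis
    using that[of "a / sqrt (a\<^sup>2 + b\<^sup>2)" "b / sqrt (a\<^sup>2 + b\<^sup>2)"] False
    by (simp add: power_divide add_divide_distrib[symmetric])
qed

text \<open>A rotation turns the linear form into its norm times the first coordinate. The other
  coordinate then integrates out with total mass 1.\<close>

lemma nn_integral_std_normal_linear_form:
  fixes C D :: real
  assumes [measurable]: "h \<in> borel_measurable borel"
  shows "(\<integral>\<^sup>+y. \<integral>\<^sup>+w. h (D * w + C * y) \<partial>std_normal \<partial>std_normal) =
    (\<integral>\<^sup>+y. h (sqrt (C\<^sup>2 + D\<^sup>2) * y) \<partial>std_normal)"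
proof -
  obtain c s where cs: "c\<^sup>2 + s\<^sup>2 = 1" "sqrt (C\<^sup>2 + D\<^sup>2) * c = C" "sqrt (C\<^sup>2 + D\<^sup>2) * s = D"
    using rotation_exists[of C D] by metis
  have "D * w + C * y = sqrt (C\<^sup>2 + D\<^sup>2) * (c * y + s * w)" for w y
    using cs(2,3) by (metis add.commute distrib_left mult.assoc)
  then have "(\<integral>\<^sup>+y. \<integral>\<^sup>+w. h (D * w + C * y) \<partial>std_normal \<partial>std_normal) =
      (\<integral>\<^sup>+y. \<integral>\<^sup>+w. h (sqrt (C\<^sup>2 + D\<^sup>2) * y) \<partial>std_normal \<partial>std_normal)"
    using nn_integral_std_normal_rotate[OF _ cs(1), of "\<lambda>p. h (sqrt (C\<^sup>2 + D\<^sup>2) * fst p)"] by simp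
  then show ?thesis by simp
qed

text \<open>A Gaussian vector in the plane is a lower triangular image of the standard one; the induction
  on \<open>S\<close> restores triangularity by rotating the new coordinate twice.\<close>
lemma joint_law_linear_forms:
  fixes u v :: "'a \<Rightarrow> real"
  assumes "finite S"
  shows "\<exists>A B C. 0 \<le> A \<and> 0 \<le> C \<and> A\<^sup>2 = (\<Sum>e\<in>S. (u e)\<^sup>2) \<and> A * B = (\<Sum>e\<in>S. u e * v e) \<and>
    B\<^sup>2 + C\<^sup>2 = (\<Sum>e\<in>S. (v e)\<^sup>2) \<and>
    (\<forall>f \<in> borel_measurable (borel \<Otimes>\<^sub>M borel).
      (\<integral>\<^sup>+a. (f (\<Sum>e\<in>S. a e * u e, \<Sum>e\<in>S. a e * v e) :: ennreal) \<partial>(\<Pi>\<^sub>M e\<in>S. std_normal)) =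
      (\<integral>\<^sup>+x. \<integral>\<^sup>+y. f (A * x, B * x + C * y) \<partial>std_normal \<partial>std_normal))"
  using assms
proof (induction S rule: finite_induct)
  case empty
  interpret product_sigma_finite "\<lambda>_ :: 'a. std_normal" ..
  show ?case
    by (intro exI[of _ 0]) (simp add: PiM_empty nn_integral_count_space_finite)
next
  case (insert e S)
  interpret product_sigma_finite "\<lambda>_ :: 'a. std_normal" ..
  from insert.IH obtain A B C where ABC: "0 \<le> A" "0 \<le> C" "A\<^sup>2 = (\<Sum>e\<in>S. (u e)\<^sup>2)"
      "A * B = (\<Sum>e\<in>S. u e * v e)" "B\<^sup>2 + C\<^sup>2 = (\<Sum>e\<in>S. (v e)\<^sup>2)"
    and IH: "\<And>f. f \<in> borel_measurable (borel \<Otimes>\<^sub>M borel) \<Longrightarrow>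
      (\<integral>\<^sup>+a. (f (\<Sum>e\<in>S. a e * u e, \<Sum>e\<in>S. a e * v e) :: ennreal) \<partial>(\<Pi>\<^sub>M e\<in>S. std_normal)) =
      (\<integral>\<^sup>+x. \<integral>\<^sup>+y. f (A * x, B * x + C * y) \<partial>std_normal \<partial>std_normal)"
    by blast
  \<comment> \<open>The first rotation acts on the old variable \<open>x\<close> and the new
    coefficient \<open>w\<close> and makes the form with coefficients \<open>A\<close>,
    \<open>u e\<close> a multiple of the first rotated coordinate.\<close>
  define A' where "A' = sqrt (A\<^sup>2 + (u e)\<^sup>2)"
  obtain c s where cs: "c\<^sup>2 + s\<^sup>2 = 1" "A' * c = A" "A' * s = u e"
    unfolding A'_def using rotation_exists[of A "u e"] by metis
  \<comment> \<open>These are the coefficients of the form \<open>B * x + w * v e\<close> in the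
    rotated coordinates. The part with \<open>D\<close> is independent of the first coordinate, and
    the second rotation merges it with the part with \<open>C\<close> into
    \<open>C'\<close>.\<close>
  define B' D where "B' = B * c + v e * s" and "D = v e * c - B * s"
  define C' where "C' = sqrt (C\<^sup>2 + D\<^sup>2)"
  have 1: "0 \<le> A'" "0 \<le> C'" "A'\<^sup>2 = (\<Sum>e\<in>insert e S. (u e)\<^sup>2)"
    using insert.hyps by (simp_all add: A'_def C'_def ABC(3)[symmetric])
  have 2: "A' * B' = (\<Sum>e\<in>insert e S. u e * v e)"
  proof -
    have "A' * B' = (A' * c) * B + (A' * s) * v e" by (simp add: B'_def algebra_simps)
    then show ?thesis using cs ABC insert.hyps by simp
  qed
  have 3: "B'\<^sup>2 + C'\<^sup>2 = (\<Sum>e\<in>insert e S. (v e)\<^sup>2)"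
  proof -
    have "C'\<^sup>2 = C\<^sup>2 + D\<^sup>2" by (simp add: C'_def)
    then have "B'\<^sup>2 + C'\<^sup>2 = (c\<^sup>2 + s\<^sup>2) * (B\<^sup>2 + (v e)\<^sup>2) + C\<^sup>2"
      by (simp add: B'_def D_def power2_eq_square algebra_simps)
    then show ?thesis using cs ABC insert.hyps by simp
  qed
  have 4: "(\<integral>\<^sup>+a. f (\<Sum>e\<in>insert e S. a e * u e, \<Sum>e\<in>insert e S. a e * v e) \<partial>(\<Pi>\<^sub>M e\<in>insert e S. std_normal)) =
      (\<integral>\<^sup>+x. \<integral>\<^sup>+y. f (A' * x, B' * x + C' * y) \<partial>std_normal \<partial>std_normal)"
    if [measurable]: "f \<in> borel_measurable (borel \<Otimes>\<^sub>M borel)" for f :: "real \<times> real \<Rightarrow> ennreal"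
  proof -
    have upd: "(\<Sum>i\<in>insert e S. (a(e := w)) i * t i) = (\<Sum>i\<in>S. a i * t i) + w * t e" for a w and t :: "'a \<Rightarrow> real"
      using insert.hyps by (auto intro!: sum.cong)
    have rot: "A * x + w * u e = A' * (c * x + s * w)"
      "B * x + w * v e = B' * (c * x + s * w) + D * (c * w - s * x)" for x w
    proof -
      show "A * x + w * u e = A' * (c * x + s * w)"
        unfolding cs(2,3)[symmetric] by (simp add: algebra_simps)
      have "B' * (c * x + s * w) + D * (c * w - s * x) = (c\<^sup>2 + s\<^sup>2) * (B * x + w * v e)"
        by (simp add: B'_def D_def power2_eq_square algebra_simps)
      then show "B * x + w * v e = B' * (c * x + s * w) + D * (c * w - s * x)"
        using cs by simp
    qed
    have "(\<integral>\<^sup>+a. f (\<Sum>e\<in>insert e S. a e * u e, \<Sum>e\<in>insert e S. a e * v e) \<partial>(\<Pi>\<^sub>M e\<in>insert e S. std_normal)) =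
        (\<integral>\<^sup>+w. \<integral>\<^sup>+a. f ((\<Sum>i\<in>S. a i * u i) + w * u e, (\<Sum>i\<in>S. a i * v i) + w * v e)
          \<partial>(\<Pi>\<^sub>M e\<in>S. std_normal) \<partial>std_normal)"
      by (subst product_nn_integral_insert_rev[OF insert.hyps]) (measurable, simp only: upd)
    also have "\<dots> = (\<integral>\<^sup>+w. \<integral>\<^sup>+x. \<integral>\<^sup>+y. f (A * x + w * u e, (B * x + C * y) + w * v e)
        \<partial>std_normal \<partial>std_normal \<partial>std_normal)"
      using IH[of "\<lambda>p. f (fst p + w * u e, snd p + w * v e)" for w] by simp
    also have "\<dots> = (\<integral>\<^sup>+w. \<integral>\<^sup>+x. \<integral>\<^sup>+y. f (A * x + w * u e, (B * x + w * v e) + C * y)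
        \<partial>std_normal \<partial>std_normal \<partial>std_normal)"
      by (simp add: algebra_simps)
    also have "\<dots> = (\<integral>\<^sup>+x. \<integral>\<^sup>+w. \<integral>\<^sup>+y. f (A * x + w * u e, (B * x + w * v e) + C * y)
        \<partial>std_normal \<partial>std_normal \<partial>std_normal)"
      by (rule std_normal_pair.Fubini') measurable
    also have "\<dots> = (\<integral>\<^sup>+x. \<integral>\<^sup>+w. \<integral>\<^sup>+y. f (A' * x, (B' * x + D * w) + C * y)
        \<partial>std_normal \<partial>std_normal \<partial>std_normal)"
      unfolding rot
      using nn_integral_std_normal_rotate[OF _ cs(1),
        of "\<lambda>p. \<integral>\<^sup>+y. f (A' * fst p, (B' * fst p + D * snd p) + C * y) \<partial>std_normal"] by simp
    also have "\<dots> = (\<integral>\<^sup>+x. \<integral>\<^sup>+y. \<integral>\<^sup>+w. f (A' * x, (B' * x + D * w) + C * y)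
        \<partial>std_normal \<partial>std_normal \<partial>std_normal)"
      by (intro nn_integral_cong std_normal_pair.Fubini') measurable
    also have "\<dots> = (\<integral>\<^sup>+x. \<integral>\<^sup>+y. \<integral>\<^sup>+w. f (A' * x, B' * x + (D * w + C * y))
        \<partial>std_normal \<partial>std_normal \<partial>std_normal)"
      by (simp add: algebra_simps)
    also have "\<dots> = (\<integral>\<^sup>+x. \<integral>\<^sup>+y. f (A' * x, B' * x + C' * y) \<partial>std_normal \<partial>std_normal)"
      unfolding C'_def by (intro nn_integral_cong nn_integral_std_normal_linear_form) measurable
    finally show ?thesis .
  qed
  show ?case using 1 2 3 4 by blast
qed

section \<open>Angles between moment vectors\<close>

text \<open>On the unit sphere the left side is the distance of two points at latitudes
  \<open>s\<close> and \<open>t\<close> whose longitudes differ by \<alpha>. The right side is the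
  longitude difference plus the latitude difference.\<close>

lemma arccos_le_add_angle:
  fixes \<alpha> s t :: real
  assumes \<alpha>: "0 \<le> \<alpha>" "\<alpha> \<le> pi / 2" and st: "0 \<le> s" "s \<le> t" "t \<le> pi / 2"
  shows "arccos (cos s * cos t * cos \<alpha> + sin s * sin t) \<le> \<alpha> + (t - s)"
proof -
  let ?q = "cos s * cos t * cos \<alpha> + sin s * sin t"
  have nn: "0 \<le> sin s" "0 \<le> sin t" "0 \<le> sin \<alpha>" "0 \<le> sin (t - s)" "0 \<le> cos s" "0 \<le> cos t"
    using \<alpha> st by (auto intro!: sin_ge_zero cos_ge_zero)
  have "?q - cos (\<alpha> + (t - s)) = sin s * sin t * (1 - cos \<alpha>) + sin \<alpha> * sin (t - s)"
    unfolding cos_add[of \<alpha>] cos_diff by (simp add: algebra_simps)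
  also have "\<dots> \<ge> 0" using nn by (intro add_nonneg_nonneg mult_nonneg_nonneg) auto
  finally have ge: "cos (\<alpha> + (t - s)) \<le> ?q" by simp
  \<comment> \<open>The antitonicity of \<open>arccos\<close> is available only on the interval from
    -1 to 1, so \<open>?q\<close> must also be bounded above.\<close>
  have "cos s * cos t * cos \<alpha> \<le> cos s * cos t * 1"
    using nn by (intro mult_left_mono) auto
  then have "?q \<le> cos (t - s)" by (simp add: cos_diff mult.commute)
  also have "\<dots> \<le> 1" by simp
  finally have le: "?q \<le> 1" .
  have "arccos ?q \<le> arccos (cos (\<alpha> + (t - s)))"
    using ge le cos_ge_minus_one[of "\<alpha> + (t - s)"] by (intro arccos_le_arccos) auto
  also have "\<dots> = \<alpha> + (t - s)" using \<alpha> st by (intro arccos_cos) auto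
  finally show ?thesis .
qed

text \<open>At \<open>t = x * y\<close> this is the inner product of the moment vectors at
  \<open>x\<close> and \<open>y\<close>, that is, the covariance of the values of the random
  polynomial there.\<close>

definition pow_sum :: "nat set \<Rightarrow> real \<Rightarrow> real" where
  "pow_sum S t = (\<Sum>e\<in>S. t ^ e)"

text \<open>The angle between the moment vectors \<open>(x ^ e)\<close> and \<open>(y ^ e)\<close>, \<open>e \<in> S\<close>.\<close>
definition angle :: "nat set \<Rightarrow> real \<Rightarrow> real \<Rightarrow> real" where
  "angle S x y = arccos (pow_sum S (x * y) / (sqrt (pow_sum S (x\<^sup>2)) * sqrt (pow_sum S (y\<^sup>2))))"

lemma pow_sum_pos:
  assumes "finite S" "S \<noteq> {}" "t > 0"
  shows "pow_sum S t > 0"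
  unfolding pow_sum_def using assms by (intro sum_pos) auto

lemma pow_sum_Cauchy_Schwarz:
  "\<bar>pow_sum S (x * y)\<bar> \<le> sqrt (pow_sum S (x\<^sup>2)) * sqrt (pow_sum S (y\<^sup>2))"
proof -
  have "pow_sum S (x * y) = (\<Sum>e\<in>S. x ^ e * y ^ e)" by (simp add: pow_sum_def power_mult_distrib)
  moreover have "pow_sum S (x\<^sup>2) = (\<Sum>e\<in>S. (x ^ e)\<^sup>2)" for x
    by (simp add: pow_sum_def power2_eq_square power_mult_distrib)
  ultimately have "(pow_sum S (x * y))\<^sup>2 \<le> pow_sum S (x\<^sup>2) * pow_sum S (y\<^sup>2)"
    using Cauchy_Schwarz_ineq_sum[of "\<lambda>e. x ^ e" "\<lambda>e. y ^ e" S] by simp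
  then have "sqrt ((pow_sum S (x * y))\<^sup>2) \<le> sqrt (pow_sum S (x\<^sup>2) * pow_sum S (y\<^sup>2))"
    by (rule real_sqrt_le_mono)
  then show ?thesis by (simp add: real_sqrt_mult)
qed

lemma angle_bounds:
  assumes "finite S" "S \<noteq> {}" "x > 0" "y > 0"
  shows "0 \<le> angle S x y" "angle S x y \<le> pi / 2"
    "cos (angle S x y) = pow_sum S (x * y) / (sqrt (pow_sum S (x\<^sup>2)) * sqrt (pow_sum S (y\<^sup>2)))"
proof -
  let ?q = "pow_sum S (x * y) / (sqrt (pow_sum S (x\<^sup>2)) * sqrt (pow_sum S (y\<^sup>2)))"
  have pos: "pow_sum S (x * y) > 0" "pow_sum S (x\<^sup>2) > 0" "pow_sum S (y\<^sup>2) > 0"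
    using assms by (auto intro!: pow_sum_pos)
  have q: "0 \<le> ?q" "?q \<le> 1"
    using pos pow_sum_Cauchy_Schwarz[of S x y] by auto
  show "angle S x y \<le> pi / 2" unfolding angle_def using q by (rule arccos_le_pi2)
  show "0 \<le> angle S x y" "cos (angle S x y) = ?q"
    unfolding angle_def using q by (auto intro: arccos_lbound simp: cos_arccos)
qed

text \<open>The angle between the moment vector of \<open>insert m S\<close> at \<open>x\<close> and its projection to \<open>S\<close>.\<close>
definition tilt :: "nat set \<Rightarrow> nat \<Rightarrow> real \<Rightarrow> real" where
  "tilt S m x = arctan (x ^ m / sqrt (pow_sum S (x\<^sup>2)))"

text \<open>The squared tangent of the tilt is the reciprocal of the sum of
  \<open>x ^ (2 * e) / x ^ (2 * m)\<close> over \<open>S\<close>, and each of these quotients is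
  nonincreasing because \<open>e \<le> m\<close>. The proof compares the terms after
  cross-multiplication.\<close>

lemma tilt_mono:
  assumes S: "finite S" "S \<noteq> {}" "\<And>e. e \<in> S \<Longrightarrow> e \<le> m" and xy: "0 < x" "x \<le> y"
  shows "tilt S m x \<le> tilt S m y"
proof -
  have pos: "pow_sum S (x\<^sup>2) > 0" "pow_sum S (y\<^sup>2) > 0"
    using S xy by (auto intro!: pow_sum_pos)
  have "(x ^ m)\<^sup>2 * (y\<^sup>2) ^ e \<le> (y ^ m)\<^sup>2 * (x\<^sup>2) ^ e" if "e \<in> S" for e
  proof -
    define d where "d = m - e"
    have m: "m = e + d" using S(3)[OF that] by (simp add: d_def)
    have "(x\<^sup>2) ^ d \<le> (y\<^sup>2) ^ d" using xy by (intro power_mono) auto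
    then have "(x\<^sup>2) ^ d * ((x\<^sup>2) ^ e * (y\<^sup>2) ^ e) \<le> (y\<^sup>2) ^ d * ((x\<^sup>2) ^ e * (y\<^sup>2) ^ e)"
      by (rule mult_right_mono) simp
    moreover have "(t ^ m)\<^sup>2 = (t\<^sup>2) ^ d * (t\<^sup>2) ^ e" for t :: real
      by (simp add: m power_add power_mult_distrib power2_eq_square ac_simps)
    ultimately show ?thesis by (simp add: ac_simps)
  qed
  then have "(x ^ m)\<^sup>2 * pow_sum S (y\<^sup>2) \<le> (y ^ m)\<^sup>2 * pow_sum S (x\<^sup>2)"
    unfolding pow_sum_def sum_distrib_left by (rule sum_mono)
  then have "sqrt ((x ^ m)\<^sup>2 * pow_sum S (y\<^sup>2)) \<le> sqrt ((y ^ m)\<^sup>2 * pow_sum S (x\<^sup>2))"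
    by (rule real_sqrt_le_mono)
  then have "x ^ m * sqrt (pow_sum S (y\<^sup>2)) \<le> y ^ m * sqrt (pow_sum S (x\<^sup>2))"
    using xy by (simp add: real_sqrt_mult)
  then show ?thesis
    using pos by (simp add: tilt_def arctan_le_iff field_simps)
qed

text \<open>With the new axis as polar axis, the tilts are the latitudes of the two unit moment
  vectors and \<open>angle S x y\<close> is their difference in longitude, so
  \<open>arccos_le_add_angle\<close> applies.\<close>

lemma angle_insert_le:
  assumes S: "finite S" "S \<noteq> {}" "\<And>e. e \<in> S \<Longrightarrow> e < m" and xy: "0 < x" "x \<le> y"
  shows "angle (insert m S) x y \<le> angle S x y + (tilt S m y - tilt S m x)"
proof -
  have "m \<notin> S" using S(3) by blast
  then have ins: "pow_sum (insert m S) t = pow_sum S t + t ^ m" for t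
    using S by (simp add: pow_sum_def)
  have cs: "cos (tilt S m x) = sqrt (pow_sum S (x\<^sup>2)) / sqrt (pow_sum (insert m S) (x\<^sup>2))"
    "sin (tilt S m x) = x ^ m / sqrt (pow_sum (insert m S) (x\<^sup>2))" if "x > 0" for x
  proof -
    have pos: "pow_sum S (x\<^sup>2) > 0" using S that by (auto intro!: pow_sum_pos)
    have "1 + (x ^ m / sqrt (pow_sum S (x\<^sup>2)))\<^sup>2 = 1 + (x ^ m)\<^sup>2 / pow_sum S (x\<^sup>2)"
      using pos by (simp only: power_divide real_sqrt_pow2 less_imp_le)
    also have "(x ^ m)\<^sup>2 = (x\<^sup>2) ^ m" by (simp only: power2_eq_square power_mult_distrib)
    also have "1 + (x\<^sup>2) ^ m / pow_sum S (x\<^sup>2) = pow_sum (insert m S) (x\<^sup>2) / pow_sum S (x\<^sup>2)"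
      using pos by (simp only: ins add_divide_distrib) simp
    finally show "cos (tilt S m x) = sqrt (pow_sum S (x\<^sup>2)) / sqrt (pow_sum (insert m S) (x\<^sup>2))"
      "sin (tilt S m x) = x ^ m / sqrt (pow_sum (insert m S) (x\<^sup>2))"
      using pos by (simp_all only: tilt_def cos_arctan sin_arctan real_sqrt_divide) simp_all
  qed
  have y: "y > 0" using xy by simp
  have pos: "pow_sum S (x\<^sup>2) > 0" "pow_sum S (y\<^sup>2) > 0"
    using S xy y by (auto intro!: pow_sum_pos)
  \<comment> \<open>Here \<open>k\<close>, \<open>l\<close> stand for the norms of the moment
    vectors over \<open>S\<close>, \<open>s\<close>, \<open>t\<close> for those over
    \<open>insert m S\<close>, and \<open>P\<close> for the inner product over
    \<open>S\<close>.\<close>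
  have alg: "(P + a * b) / (s * t) = k / s * (l / t) * (P / (k * l)) + a / s * (b / t)"
    if "k \<noteq> 0" "l \<noteq> 0" for P a b s t k l :: real
    using that by (simp add: add_divide_distrib)
  have "pow_sum (insert m S) (x * y) / (sqrt (pow_sum (insert m S) (x\<^sup>2)) * sqrt (pow_sum (insert m S) (y\<^sup>2))) =
      cos (tilt S m x) * cos (tilt S m y) * cos (angle S x y) + sin (tilt S m x) * sin (tilt S m y)"
    unfolding cs[OF xy(1)] cs[OF y] angle_bounds(3)[OF S(1,2) xy(1) y] ins[of "x * y"]
      power_mult_distrib[of x y m] by (rule alg) (use pos in auto)
  then have "angle (insert m S) x y =
      arccos (cos (tilt S m x) * cos (tilt S m y) * cos (angle S x y) + sin (tilt S m x) * sin (tilt S m y))"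
    by (simp add: angle_def)
  also have "\<dots> \<le> angle S x y + (tilt S m y - tilt S m x)"
  proof (rule arccos_le_add_angle)
    show "tilt S m x \<le> tilt S m y" using S xy by (intro tilt_mono) (auto intro: less_imp_le)
    show "0 \<le> tilt S m x" using xy pos by (simp add: tilt_def)
    show "tilt S m y \<le> pi / 2" using arctan_ubound by (simp add: tilt_def less_imp_le)
  qed (use angle_bounds[OF S(1,2) xy(1) y] in auto)
  finally show ?thesis .
qed

lemma angle_singleton:
  assumes "x > 0" "y > 0"
  shows "angle {m} x y = 0"
proof -
  have "sqrt ((t\<^sup>2) ^ m) = t ^ m" if "t > 0" for t
    using that by (simp add: real_sqrt_power)
  then show ?thesis using assms by (simp add: angle_def pow_sum_def power_mult_distrib)
qed

text \<open>The tilt increments telescope, so the extra cost is at most the tilt at 1, independently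
  of the grid.\<close>

lemma sum_angle_insert_le:
  fixes p :: "nat \<Rightarrow> real"
  assumes S: "finite S" "S \<noteq> {}" "\<And>e. e \<in> S \<Longrightarrow> e < m"
    and p: "\<And>i. 0 < p i" "mono p" "p n \<le> 1"
  shows "(\<Sum>i<n. angle (insert m S) (p i) (p (Suc i))) \<le>
    (\<Sum>i<n. angle S (p i) (p (Suc i))) + arctan (1 / sqrt (card S))"
proof -
  have "(\<Sum>i<n. angle (insert m S) (p i) (p (Suc i))) \<le>
      (\<Sum>i<n. angle S (p i) (p (Suc i)) + (tilt S m (p (Suc i)) - tilt S m (p i)))"
    using S p by (intro sum_mono angle_insert_le) (auto simp: incseq_SucD)
  also have "\<dots> = (\<Sum>i<n. angle S (p i) (p (Suc i))) + (tilt S m (p n) - tilt S m (p 0))"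
    using sum_lessThan_telescope[of "\<lambda>i. tilt S m (p i)" n] by (simp add: sum.distrib)
  finally have "(\<Sum>i<n. angle (insert m S) (p i) (p (Suc i))) \<le>
      (\<Sum>i<n. angle S (p i) (p (Suc i))) + (tilt S m (p n) - tilt S m (p 0))" .
  moreover have "tilt S m (p n) \<le> tilt S m 1"
    using S p by (intro tilt_mono) (auto intro: less_imp_le)
  moreover have "tilt S m 1 = arctan (1 / sqrt (card S))" by (simp add: tilt_def pow_sum_def)
  moreover have "0 \<le> tilt S m (p 0)"
    using p(1)[of 0] pow_sum_pos[OF S(1,2), of "(p 0)\<^sup>2"] by (simp add: tilt_def)
  ultimately show ?thesis by linarith
qed

text \<open>Rationalising the difference of roots leaves the factor
  \<open>sqrt t + sqrt (t - 1)\<close>, which is at most \<open>2 * sqrt t\<close>.\<close>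

lemma inverse_sqrt_le_sqrt_diff:
  fixes t :: real
  assumes "t \<ge> 1"
  shows "1 / sqrt t \<le> 2 * (sqrt t - sqrt (t - 1))"
proof -
  have "1 = (sqrt t - sqrt (t - 1)) * (sqrt t + sqrt (t - 1))"
    using assms by (simp add: algebra_simps)
  also have "\<dots> \<le> (sqrt t - sqrt (t - 1)) * (2 * sqrt t)"
    using assms by (intro mult_left_mono) auto
  finally show ?thesis using assms by (simp add: field_simps)
qed

lemma sum_angle_le:
  fixes p :: "nat \<Rightarrow> real"
  assumes "finite S" "card S = k" "k \<ge> 2" and p: "\<And>i. 0 < p i" "mono p" "p n \<le> 1"
  shows "(\<Sum>i<n. angle S (p i) (p (Suc i))) \<le> pi / 4 + 2 * (sqrt (real k - 1) - 1)"
  using assms(3,1,2)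
proof (induction k arbitrary: S rule: dec_induct)
  \<comment> \<open>A singleton contributes no angle, and adding the second exponent costs
    \<open>arctan 1\<close>. Keeping this value exact gives the 1/4 of the final bound.\<close>
  case base
  then obtain x y where xy: "S = {x, y}" "x \<noteq> y" by (auto simp: card_2_iff)
  define a b where "a = min x y" and "b = max x y"
  have "S = insert b {a}" "\<And>e. e \<in> {a} \<Longrightarrow> e < b"
    using xy by (auto simp: a_def b_def min_def max_def)
  then have "(\<Sum>i<n. angle S (p i) (p (Suc i))) \<le>
      (\<Sum>i<n. angle {a} (p i) (p (Suc i))) + arctan (1 / sqrt (card {a}))"
    using sum_angle_insert_le[OF _ _ _ p, of "{a}" b] by simp
  then show ?case using p(1) by (simp add: angle_singleton arctan_one)
next
  case (step k)
  define m where "m = Max S"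
  define S' where "S' = S - {m}"
  have "S \<noteq> {}" using step.prems by auto
  then have m: "m \<in> S" "\<And>e. e \<in> S' \<Longrightarrow> e < m"
    using step.prems by (auto simp: m_def S'_def less_le)
  have S': "finite S'" "card S' = k" "S = insert m S'"
    using m(1) step.prems by (auto simp: S'_def)
  have "S' \<noteq> {}" using S'(2) step.hyps by auto
  then have "(\<Sum>i<n. angle S (p i) (p (Suc i))) \<le>
      (\<Sum>i<n. angle S' (p i) (p (Suc i))) + arctan (1 / sqrt k)"
    unfolding S'(3) S'(2)[symmetric] by (intro sum_angle_insert_le S'(1) m(2) p)
  \<comment> \<open>From the third exponent on, this cruder bound suffices: it is dominated by an
    increment of \<open>2 * sqrt\<close>, which the induction hypothesis absorbs.\<close>
  also have "arctan (1 / sqrt k) \<le> 1 / sqrt k"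
    by (rule arctan_le_self) simp
  also have "\<dots> \<le> 2 * (sqrt k - sqrt (real k - 1))"
    using step.hyps by (intro inverse_sqrt_le_sqrt_diff) simp
  finally show ?case using step.IH[OF S'(1,2)] by simp
qed

section \<open>Probability of a sign change\<close>

text \<open>The right side is the Cauchy density, the law of the ratio of two independent normal
  variables. Scaling by \<open>r = sqrt (1 + \<tau>\<^sup>2)\<close> reduces the integral to the
  first absolute moment of a normal variable.\<close>

lemma nn_integral_std_normal_density_ray:
  "(\<integral>\<^sup>+x. ennreal (\<bar>x\<bar> * (std_normal_density x * std_normal_density (x * \<tau>))) \<partial>lborel) =
    ennreal (1 / (pi * (1 + \<tau>\<^sup>2)))"
proof -
  define r where "r = sqrt (1 + \<tau>\<^sup>2)"
  have r: "r > 0" "r\<^sup>2 = 1 + \<tau>\<^sup>2" by (simp_all add: r_def add_pos_nonneg)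
  define g where "g x = ennreal (std_normal_density x * \<bar>x\<bar>)" for x
  have [measurable]: "g \<in> borel_measurable borel" unfolding g_def by measurable
  have "(\<integral>\<^sup>+x. g x \<partial>lborel) = ennreal (sqrt (2 / pi))"
    unfolding g_def using std_normal_moment_abs_odd[of 0]
    by (subst nn_integral_eq_integral) (auto simp: has_bochner_integral_iff)
  then have g: "(\<integral>\<^sup>+x. g (r * x) \<partial>lborel) = ennreal (1 / r) * ennreal (sqrt (2 / pi))"
    using r(1) nn_integral_real_affine[of "\<lambda>x. g (r * x)" "1 / r" 0] by simp
  have eq: "\<bar>x\<bar> * (std_normal_density x * std_normal_density (x * \<tau>)) =
      1 / (r * sqrt (2 * pi)) * (std_normal_density (r * x) * \<bar>r * x\<bar>)" for x
  proof -
    have "- x\<^sup>2 / 2 + - (x * \<tau>)\<^sup>2 / 2 = - (r * x)\<^sup>2 / 2"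
      using r(2) by (simp add: power_mult_distrib field_simps)
    then have "exp (- x\<^sup>2 / 2) * exp (- (x * \<tau>)\<^sup>2 / 2) = exp (- (r * x)\<^sup>2 / 2)"
      by (metis exp_add)
    then have "std_normal_density x * std_normal_density (x * \<tau>) =
        1 / sqrt (2 * pi) * std_normal_density (r * x)"
      by (simp add: std_normal_density_def)
    then show ?thesis using r(1) by (simp add: abs_mult)
  qed
  have "(\<integral>\<^sup>+x. ennreal (\<bar>x\<bar> * (std_normal_density x * std_normal_density (x * \<tau>))) \<partial>lborel) =
      (\<integral>\<^sup>+x. ennreal (1 / (r * sqrt (2 * pi))) * g (r * x) \<partial>lborel)"
    unfolding g_def eq using r(1) by (intro nn_integral_cong ennreal_mult) auto
  also have "\<dots> = ennreal (1 / (r * sqrt (2 * pi))) * (ennreal (1 / r) * ennreal (sqrt (2 / pi)))"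
    by (subst nn_integral_cmult) (auto simp: g)
  also have "\<dots> = ennreal (1 / (r * sqrt (2 * pi)) * (1 / r * sqrt (2 / pi)))"
    using r(1) by (simp add: ennreal_mult[symmetric])
  also have "1 / (r * sqrt (2 * pi)) * (1 / r * sqrt (2 / pi)) = 1 / (pi * r\<^sup>2)"
    using r(1) by (simp add: real_sqrt_mult real_sqrt_divide power2_eq_square field_simps)
  finally show ?thesis by (simp add: r(2))
qed

text \<open>The value 0 is grouped with the negative ones, so a passage between strict signs through
  a sampled 0 is counted exactly once.\<close>

definition sign_change :: "(real \<times> real) set" where
  "sign_change = {p. (fst p > 0) \<noteq> (snd p > 0)}"

lemma sign_change_measurable [measurable]: "sign_change \<in> sets (borel \<Otimes>\<^sub>M borel)"
proof -
  have "{p \<in> space (borel \<Otimes>\<^sub>M borel). (fst p > (0::real)) \<noteq> (snd p > (0::real))} \<in>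
      sets (borel \<Otimes>\<^sub>M borel)"
    by measurable
  then show ?thesis by (simp add: sign_change_def space_pair_measure)
qed

text \<open>Substituting \<open>y = - x * \<tau>\<close> turns the double sector into the half-line \<open>\<tau> \<ge> B / C\<close>.\<close>
lemma nn_integral_double_sector_le:
  fixes A B C :: real
  assumes A: "A > 0" and C: "C > 0"
  shows "(\<integral>\<^sup>+x. \<integral>\<^sup>+y. indicator sign_change (A * x, B * x + C * y) \<partial>std_normal \<partial>std_normal) \<le>
    ennreal ((pi / 2 - arctan (B / C)) / pi)"
proof -
  have "(\<integral>\<^sup>+x. \<integral>\<^sup>+y. indicator sign_change (A * x, B * x + C * y) \<partial>std_normal \<partial>std_normal) =
      (\<integral>\<^sup>+x. \<integral>\<^sup>+y. ennreal (std_normal_density x * std_normal_density y) *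
        indicator sign_change (A * x, B * x + C * y) \<partial>lborel \<partial>lborel)"
    using nn_integral_std_normal_pair[of "\<lambda>p. indicator sign_change (A * fst p, B * fst p + C * snd p)"]
    by simp
  also have "\<dots> \<le> (\<integral>\<^sup>+x. \<integral>\<^sup>+\<tau>. ennreal (\<bar>x\<bar> * (std_normal_density x * std_normal_density (x * \<tau>))) *
        indicator {B / C..} \<tau> \<partial>lborel \<partial>lborel)"
  \<comment> \<open>The substitution is singular at \<open>x = 0\<close>, which is a null
    set.\<close>
  proof (rule nn_integral_mono_AE)
    have "(\<integral>\<^sup>+y. ennreal (std_normal_density x * std_normal_density y) *
          indicator sign_change (A * x, B * x + C * y) \<partial>lborel) \<le>
        (\<integral>\<^sup>+\<tau>. ennreal (\<bar>x\<bar> * (std_normal_density x * std_normal_density (x * \<tau>))) *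
          indicator {B / C..} \<tau> \<partial>lborel)" if x: "x \<noteq> 0" for x
    proof -
      \<comment> \<open>After the substitution the second form is
        \<open>x * (B - C * \<tau>)\<close>, and the first has the sign of \<open>x\<close>. They
        can disagree only if \<open>B - C * \<tau>\<close> is not positive.\<close>
      have sub: "(A * x, B * x + C * (0 + - x * \<tau>)) \<in> sign_change \<Longrightarrow> B / C \<le> \<tau>" for \<tau>
      proof -
        assume "(A * x, B * x + C * (0 + - x * \<tau>)) \<in> sign_change"
        moreover have "B * x + C * (0 + - x * \<tau>) = x * (B - C * \<tau>)" by (simp add: algebra_simps)
        moreover have "A * x > 0 \<longleftrightarrow> x > 0" using A by (simp add: zero_less_mult_iff)
        ultimately have "(x > 0) \<noteq> (x * (B - C * \<tau>) > 0)"
          by (simp only: sign_change_def mem_Collect_eq fst_conv snd_conv not_False_eq_True)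
        then have "B - C * \<tau> \<le> 0" using x by (auto simp: zero_less_mult_iff)
        then show ?thesis using C by (simp add: field_simps)
      qed
      have "(\<integral>\<^sup>+y. ennreal (std_normal_density x * std_normal_density y) *
            indicator sign_change (A * x, B * x + C * y) \<partial>lborel) =
          ennreal \<bar>- x\<bar> * (\<integral>\<^sup>+\<tau>. ennreal (std_normal_density x * std_normal_density (0 + - x * \<tau>)) *
            indicator sign_change (A * x, B * x + C * (0 + - x * \<tau>)) \<partial>lborel)"
        using x by (intro nn_integral_real_affine) auto
      also have "\<dots> = (\<integral>\<^sup>+\<tau>. ennreal \<bar>- x\<bar> * (ennreal (std_normal_density x * std_normal_density (0 + - x * \<tau>)) *
            indicator sign_change (A * x, B * x + C * (0 + - x * \<tau>))) \<partial>lborel)"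
        by (rule nn_integral_cmult[symmetric]) measurable
      also have "\<dots> \<le> (\<integral>\<^sup>+\<tau>. ennreal (\<bar>x\<bar> * (std_normal_density x * std_normal_density (x * \<tau>))) *
            indicator {B / C..} \<tau> \<partial>lborel)"
      proof (rule nn_integral_mono)
        fix \<tau> :: real
        have "std_normal_density (0 + - x * \<tau>) = std_normal_density (x * \<tau>)"
          by (simp add: std_normal_density_def)
        then show "ennreal \<bar>- x\<bar> * (ennreal (std_normal_density x * std_normal_density (0 + - x * \<tau>)) *
            indicator sign_change (A * x, B * x + C * (0 + - x * \<tau>))) \<le>
          ennreal (\<bar>x\<bar> * (std_normal_density x * std_normal_density (x * \<tau>))) * indicator {B / C..} \<tau>"
          using sub[of \<tau>] by (auto simp: ennreal_mult indicator_def)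
      qed
      finally show ?thesis .
    qed
    then show "AE x in lborel. (\<integral>\<^sup>+y. ennreal (std_normal_density x * std_normal_density y) *
          indicator sign_change (A * x, B * x + C * y) \<partial>lborel) \<le>
        (\<integral>\<^sup>+\<tau>. ennreal (\<bar>x\<bar> * (std_normal_density x * std_normal_density (x * \<tau>))) *
          indicator {B / C..} \<tau> \<partial>lborel)"
      using AE_lborel_singleton[of "0::real"] by (auto elim: eventually_mono)
  qed
  also have "\<dots> = (\<integral>\<^sup>+\<tau>. \<integral>\<^sup>+x. ennreal (\<bar>x\<bar> * (std_normal_density x * std_normal_density (x * \<tau>))) *
        indicator {B / C..} \<tau> \<partial>lborel \<partial>lborel)"
    by (rule lborel_pair.Fubini') measurable
  also have "\<dots> = (\<integral>\<^sup>+\<tau>. ennreal (1 / (pi * (1 + \<tau>\<^sup>2))) * indicator {B / C..} \<tau> \<partial>lborel)"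
    by (subst nn_integral_multc) (auto simp: nn_integral_std_normal_density_ray)
  also have "\<dots> = ennreal (1 / 2 - arctan (B / C) / pi)"
  proof (rule nn_integral_FTC_atLeast)
    show "((\<lambda>x. arctan x / pi) has_real_derivative 1 / (pi * (1 + x\<^sup>2))) (at x)" for x
      by (auto intro!: derivative_eq_intros simp: field_simps add_nonneg_eq_0_iff)
    have "((\<lambda>x. arctan x / pi) \<longlongrightarrow> (pi / 2) / pi) at_top"
      by (intro tendsto_intros tendsto_arctan_at_top) auto
    then show "((\<lambda>x. arctan x / pi) \<longlongrightarrow> 1 / 2) at_top" by simp
  qed (auto intro!: divide_nonneg_nonneg)
  also have "1 / 2 - arctan (B / C) / pi = (pi / 2 - arctan (B / C)) / pi"
    by (simp add: diff_divide_distrib)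
  finally show ?thesis .
qed

lemma arccos_eq_pi_half_minus_arctan:
  fixes B C :: real
  assumes "C > 0"
  shows "arccos (B / sqrt (B\<^sup>2 + C\<^sup>2)) = pi / 2 - arctan (B / C)"
proof -
  let ?\<alpha> = "pi / 2 - arctan (B / C)"
  have "1 + (B / C)\<^sup>2 = (B\<^sup>2 + C\<^sup>2) / C\<^sup>2" using assms by (simp add: field_simps)
  then have "B / sqrt (B\<^sup>2 + C\<^sup>2) = sin (arctan (B / C))"
    using assms by (simp add: sin_arctan real_sqrt_divide)
  also have "\<dots> = cos ?\<alpha>" by (simp add: cos_diff)
  finally show ?thesis
    using arctan_bounded[of "B / C"] by (simp only:) (rule arccos_cos, auto)
qed

text \<open>The planar vectors \<open>(A, 0)\<close> and \<open>(B, C)\<close> have the same Gram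
  matrix as the two moment vectors, hence enclose the same angle.\<close>

lemma nn_integral_sign_change_le:
  assumes S: "finite S" "S \<noteq> {}" and xy: "x > 0" "y > 0"
  shows "(\<integral>\<^sup>+a. indicator sign_change (rand_poly S a x, rand_poly S a y) \<partial>coeff_measure S) \<le>
    ennreal (angle S x y / pi)"
proof -
  obtain A B C where ABC: "0 \<le> A" "0 \<le> C" "A\<^sup>2 = (\<Sum>e\<in>S. (x ^ e)\<^sup>2)" "A * B = (\<Sum>e\<in>S. x ^ e * y ^ e)"
      "B\<^sup>2 + C\<^sup>2 = (\<Sum>e\<in>S. (y ^ e)\<^sup>2)"
    and law: "\<And>f :: _ \<Rightarrow> ennreal. f \<in> borel_measurable (borel \<Otimes>\<^sub>M borel) \<Longrightarrow>
      (\<integral>\<^sup>+a. f (\<Sum>e\<in>S. a e * x ^ e, \<Sum>e\<in>S. a e * y ^ e) \<partial>(\<Pi>\<^sub>M e\<in>S. std_normal)) =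
      (\<integral>\<^sup>+x. \<integral>\<^sup>+y. f (A * x, B * x + C * y) \<partial>std_normal \<partial>std_normal)"
    using joint_law_linear_forms[OF S(1), of "\<lambda>e. x ^ e" "\<lambda>e. y ^ e"] by blast
  have sq: "(t ^ e)\<^sup>2 = (t\<^sup>2) ^ e" for t :: real and e
    by (simp add: power2_eq_square power_mult_distrib)
  have K: "A\<^sup>2 = pow_sum S (x\<^sup>2)" "A * B = pow_sum S (x * y)" "B\<^sup>2 + C\<^sup>2 = pow_sum S (y\<^sup>2)"
    using ABC by (simp_all only: sq pow_sum_def power_mult_distrib)
  have "A * B > 0" unfolding K using S xy by (intro pow_sum_pos) auto
  then have AB: "A > 0" "B > 0" using ABC(1) by (auto simp: zero_less_mult_iff)
  have "sqrt (pow_sum S (x\<^sup>2)) = A" unfolding K(1)[symmetric] using AB by simp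
  then have angle: "angle S x y = arccos (B / sqrt (B\<^sup>2 + C\<^sup>2))"
    unfolding angle_def K(2)[symmetric] K(3)[symmetric] using AB by simp
  have "(\<integral>\<^sup>+a. indicator sign_change (rand_poly S a x, rand_poly S a y) \<partial>coeff_measure S) =
      (\<integral>\<^sup>+x. \<integral>\<^sup>+y. indicator sign_change (A * x, B * x + C * y) \<partial>std_normal \<partial>std_normal)"
    unfolding rand_poly_def coeff_measure_def by (rule law) measurable
  also have "\<dots> \<le> ennreal (angle S x y / pi)"
  proof (cases "C = 0")
    \<comment> \<open>Both values are then positive multiples of the same normal variable, so their
      signs always agree.\<close>
    case True
    then have "(A * s, B * s + C * t) \<notin> sign_change" for s t
      using AB by (simp add: sign_change_def zero_less_mult_iff)
    then show ?thesis by simp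
  next
    case False
    with ABC(2) have C: "C > 0" by simp
    show ?thesis
      unfolding angle arccos_eq_pi_half_minus_arctan[OF C]
      by (rule nn_integral_double_sector_le[OF AB(1) C])
  qed
  finally show ?thesis .
qed

section \<open>Zeros and sign changes\<close>

text \<open>The shift by one keeps all points strictly positive, where moment vectors do not vanish,
  and places the point with index \<open>n\<close> at 1.\<close>

definition grid :: "nat \<Rightarrow> nat \<Rightarrow> real" where
  "grid n i = real (Suc i) / real (Suc n)"

lemma grid_pos: "grid n i > 0"
  by (simp add: grid_def)

lemma grid_mono: "mono (grid n)"
  by (auto simp: mono_def grid_def intro!: divide_right_mono)

lemma grid_self: "grid n n = 1"
  by (simp add: grid_def)

text \<open>The sign change occurs in a cell containing the zero. That this cell ends before
  \<open>z + d\<close> serves to show later that distinct zeros get distinct cells.\<close>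

lemma grid_sign_change:
  fixes f :: "real \<Rightarrow> real" and z d :: real
  assumes z: "0 < z" "z < 1" "f z = 0" and d: "d > 0"
    and sgn: "(\<forall>h>0. h < d \<longrightarrow> f (z - h) < 0 \<and> f (z + h) > 0) \<or> (\<forall>h>0. h < d \<longrightarrow> f (z - h) > 0 \<and> f (z + h) < 0)"
    and n: "2 / real (Suc n) < z" "1 / real (Suc n) < d"
  shows "\<exists>i<n. grid n i \<le> z \<and> z \<le> grid n (Suc i) \<and> grid n (Suc i) < z + d \<and>
    (f (grid n i) > 0) \<noteq> (f (grid n (Suc i)) > 0)"
proof -
  define m where "m = real (Suc n)"
  have m: "m > 0" "2 / m < z" "1 / m < d" using n by (simp_all add: m_def)
  define k where "k = nat \<lfloor>z * m\<rfloor>"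
  have zm: "z * m > 2" "z * m < m" using m z by (simp_all add: field_simps)
  then have k: "real k \<le> z * m" "z * m < real k + 1" "2 \<le> k"
    unfolding k_def by linarith+
  have "real k < m" using k zm by linarith
  then have kn: "k \<le> n" by (simp add: m_def)
  \<comment> \<open>The zero lies in cell \<open>Suc j\<close>, at or to the right of the grid point
    \<open>k / m\<close>. The assumption \<open>2 / real (Suc n) < z\<close> ensures that a cell
    \<open>j\<close> to its left exists.\<close>
  define j where "j = k - 2"
  have j: "k = Suc (Suc j)" using k(3) by (simp add: j_def)
  have g: "grid n j = (real k - 1) / m" "grid n (Suc j) = real k / m" "grid n (Suc (Suc j)) = (real k + 1) / m"
    by (simp_all add: grid_def j m_def)
  have step: "grid n (Suc j) = grid n j + 1 / m" "grid n (Suc (Suc j)) = grid n (Suc j) + 1 / m"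
    using m(1) by (simp_all add: g field_simps)
  have lo: "grid n (Suc j) \<le> z" and hi: "z < grid n (Suc (Suc j))"
    using k m(1) by (simp_all add: g field_simps)
  have left: "(\<exists>h>0. h < d \<and> x = z - h)" if "x < z" "z < x + d" for x
    using that by (intro exI[of _ "z - x"]) auto
  have right: "(\<exists>h>0. h < d \<and> x = z + h)" if "z < x" "x < z + d" for x
    using that by (intro exI[of _ "x - z"]) auto
  have hi': "grid n (Suc (Suc j)) < z + d" using step lo m(3) by linarith
  have R: "\<exists>h>0. h < d \<and> grid n (Suc (Suc j)) = z + h"
    using hi hi' by (intro right) auto
  show ?thesis
  proof (cases "grid n (Suc j) = z")
    case False
    have L: "\<exists>h>0. h < d \<and> grid n (Suc j) = z - h"
      using lo False hi step m(3) by (intro left) linarith+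
    obtain h1 h2 where h: "h1 > 0" "h1 < d" "grid n (Suc j) = z - h1"
      "h2 > 0" "h2 < d" "grid n (Suc (Suc j)) = z + h2"
      using L R by blast
    have "f (z - h1) < 0 \<and> f (z + h2) > 0 \<or> f (z - h1) > 0 \<and> f (z + h2) < 0"
      using sgn h(1,2,4,5) by blast
    then have "(f (grid n (Suc j)) > 0) \<noteq> (f (grid n (Suc (Suc j))) > 0)"
      unfolding h(3,6) by auto
    then show ?thesis using lo hi hi' kn j by (intro exI[of _ "Suc j"]) auto
  next
    case True
    have pos: "1 / m > 0" using m(1) by simp
    have L: "\<exists>h>0. h < d \<and> grid n j = z - h"
      using True step m(3) pos by (intro left) linarith+
    from sgn show ?thesis
    proof
      assume "\<forall>h>0. h < d \<longrightarrow> f (z - h) < 0 \<and> f (z + h) > 0"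
      then have "f (grid n (Suc (Suc j))) > 0" using R by auto
      then show ?thesis using True z(3) hi hi' kn j by (intro exI[of _ "Suc j"]) auto
    next
      \<comment> \<open>At the grid point \<open>z\<close> the value 0 counts as not positive, so a
        decreasing passage is registered in the preceding cell \<open>j\<close>.\<close>
      assume "\<forall>h>0. h < d \<longrightarrow> f (z - h) > 0 \<and> f (z + h) < 0"
      then have "f (grid n j) > 0" using L by auto
      moreover have "grid n j \<le> z" using True step pos by linarith
      ultimately show ?thesis using True z(3) d kn j by (intro exI[of _ j]) auto
    qed
  qed
qed

lemma simple_zero_sign_pattern:
  fixes f :: "real \<Rightarrow> real" and l z :: real
  assumes "(f has_real_derivative l) (at z)" "l \<noteq> 0" "f z = 0"
  shows "\<exists>d>0. (\<forall>h>0. h < d \<longrightarrow> f (z - h) < 0 \<and> f (z + h) > 0) \<or>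
    (\<forall>h>0. h < d \<longrightarrow> f (z - h) > 0 \<and> f (z + h) < 0)"
proof (cases "l > 0")
  case True
  obtain d1 d2 where "d1 > 0" "\<And>h. h > 0 \<Longrightarrow> h < d1 \<Longrightarrow> f (z - h) < 0"
      "d2 > 0" "\<And>h. h > 0 \<Longrightarrow> h < d2 \<Longrightarrow> f (z + h) > 0"
    using DERIV_pos_inc_left[OF assms(1) True] DERIV_pos_inc_right[OF assms(1) True] assms(3) by auto
  then show ?thesis by (intro exI[of _ "min d1 d2"]) auto
next
  case False
  then have l: "l < 0" using assms(2) by simp
  obtain d1 d2 where "d1 > 0" "\<And>h. h > 0 \<Longrightarrow> h < d1 \<Longrightarrow> f (z - h) > 0"
      "d2 > 0" "\<And>h. h > 0 \<Longrightarrow> h < d2 \<Longrightarrow> f (z + h) < 0"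
    using DERIV_neg_dec_left[OF assms(1) l] DERIV_neg_dec_right[OF assms(1) l] assms(3) by auto
  then show ?thesis by (intro exI[of _ "min d1 d2"]) auto
qed

text \<open>For a fine grid, each of the finitely many zeros is assigned a cell with a sign change,
  and this assignment is injective.\<close>

lemma eventually_card_zeros_le_grid_sign_changes:
  fixes f f' :: "real \<Rightarrow> real"
  assumes fin: "finite {x \<in> {0<..<1}. f x = 0}"
    and deriv: "\<And>x. (f has_real_derivative f' x) (at x)"
    and simple: "\<And>x. 0 < x \<Longrightarrow> x < 1 \<Longrightarrow> f x = 0 \<Longrightarrow> f' x \<noteq> 0"
  shows "\<forall>\<^sub>F n in sequentially. card {x \<in> {0<..<1}. f x = 0} \<le>
    card {i. i < n \<and> (f (grid n i) > 0) \<noteq> (f (grid n (Suc i)) > 0)}"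
proof -
  define Z where "Z = {x \<in> {0<..<1}. f x = 0}"
  define pat where "pat z d \<longleftrightarrow> d > 0 \<and> ((\<forall>h>0. h < d \<longrightarrow> f (z - h) < 0 \<and> f (z + h) > 0) \<or>
    (\<forall>h>0. h < d \<longrightarrow> f (z - h) > 0 \<and> f (z + h) < 0))" for z d
  have "\<forall>z\<in>Z. \<exists>d. pat z d"
    using simple_zero_sign_pattern[OF deriv] simple by (auto simp: Z_def pat_def)
  then obtain d where d: "\<And>z. z \<in> Z \<Longrightarrow> pat z (d z)" by metis
  have lim: "(\<lambda>n. c / real (Suc n)) \<longlonglongrightarrow> 0" for c
    by (rule LIMSEQ_Suc[OF lim_const_over_n])
  have "\<forall>\<^sub>F n in sequentially. \<forall>z\<in>Z. 2 / real (Suc n) < z \<and> 1 / real (Suc n) < d z"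
    using fin d unfolding Z_def[symmetric]
    by (intro eventually_ball_finite ballI eventually_conj order_tendstoD(2)[OF lim])
      (auto simp: Z_def pat_def)
  then show ?thesis
  proof eventually_elim
    case (elim n)
    let ?P = "\<lambda>z i. i < n \<and> grid n i \<le> z \<and> z \<le> grid n (Suc i) \<and> grid n (Suc i) < z + d z \<and>
      (f (grid n i) > 0) \<noteq> (f (grid n (Suc i)) > 0)"
    have "\<forall>z\<in>Z. \<exists>i. ?P z i"
      using grid_sign_change[of _ f "d _" n] elim d by (auto simp: Z_def pat_def)
    then obtain idx where idx: "\<And>z. z \<in> Z \<Longrightarrow> ?P z (idx z)" by metis
    \<comment> \<open>A larger zero \<open>z'\<close> in the same cell would lie in the interval
      from \<open>z\<close> to \<open>z + d z\<close>, on which \<open>f\<close> has a strict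
      sign.\<close>
    have le: "z' \<le> z" if "z \<in> Z" "z' \<in> Z" "idx z = idx z'" for z z'
    proof (rule ccontr)
      assume "\<not> z' \<le> z"
      moreover have "z' < z + d z" using idx[OF that(1)] idx[OF that(2)] that(3) by auto
      ultimately have "z' - z > 0" "z' - z < d z" by simp_all
      then have "f (z + (z' - z)) < 0 \<or> f (z + (z' - z)) > 0"
        using d[OF that(1)] unfolding pat_def by blast
      then show False using that(2) by (simp add: Z_def)
    qed
    have "inj_on idx Z" by (rule inj_onI) (simp add: le antisym)
    then have "card Z = card (idx ` Z)" by (simp add: card_image)
    also have "\<dots> \<le> card {i. i < n \<and> (f (grid n i) > 0) \<noteq> (f (grid n (Suc i)) > 0)}"
      using idx by (intro card_mono) auto
    finally show ?case by (simp add: Z_def)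
  qed
qed

section \<open>Almost sure absence of double zeros\<close>

definition rand_poly_deriv :: "nat set \<Rightarrow> (nat \<Rightarrow> real) \<Rightarrow> real \<Rightarrow> real" where
  "rand_poly_deriv S a x = (\<Sum>e\<in>S. a e * (real e * x ^ (e - 1)))"

lemma has_real_derivative_rand_poly:
  "(rand_poly S a has_real_derivative rand_poly_deriv S a x) (at x)"
  unfolding rand_poly_def[abs_def] rand_poly_deriv_def
  by (auto intro!: derivative_eq_intros sum.cong)

lemma continuous_on_rand_poly: "continuous_on X (rand_poly S a)"
  and continuous_on_rand_poly_deriv: "continuous_on X (rand_poly_deriv S a)"
  unfolding rand_poly_def[abs_def] rand_poly_deriv_def[abs_def] by (intro continuous_intros)+

lemma finite_zeros_rand_poly:
  assumes "finite S" "e \<in> S" "a e \<noteq> 0"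
  shows "finite {x. rand_poly S a x = 0}"
proof -
  define c where "c i = (if i \<in> S then a i else 0)" for i
  have "rand_poly S a x = (\<Sum>i\<le>Max S. c i * x ^ i)" for x
    unfolding rand_poly_def c_def using assms(1)
    by (intro sum.mono_neutral_cong_left) auto
  moreover have "e \<le> Max S" "c e \<noteq> 0" using assms by (auto simp: c_def)
  ultimately show ?thesis using polyfun_rootbound_finite[of "Max S" c] by auto
qed

text \<open>With the other coefficients fixed, a double zero at \<open>x\<close> forces \<open>x\<close> to be a critical point of
  \<open>x \<mapsto> rand_poly S a x / x ^ m\<close> and \<open>- w\<close> to be the corresponding critical value.\<close>
lemma finite_double_zero_coeffs:
  assumes S: "finite S" "m \<notin> S"
  shows "finite {w. \<exists>x>0. rand_poly (insert m S) (a(m := w)) x = 0 \<and>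
    rand_poly_deriv (insert m S) (a(m := w)) x = 0}" (is "finite ?W")
proof -
  \<comment> \<open>These are the coefficients of \<open>x ^ (m + 1)\<close> times the derivative of
    \<open>rand_poly S a x / x ^ m\<close>. Since \<open>m \<notin> S\<close>, they vanish only
    where those of \<open>a\<close> do.\<close>
  define b where "b e = a e * (real e - real m)" for e
  have ins: "rand_poly (insert m S) (a(m := w)) x = w * x ^ m + rand_poly S a x"
    "rand_poly_deriv (insert m S) (a(m := w)) x = w * (real m * x ^ (m - 1)) + rand_poly_deriv S a x" for w x
    using S by (auto simp: rand_poly_def rand_poly_deriv_def intro!: sum.cong)
  have pw: "x * (real e * x ^ (e - 1)) = real e * x ^ e" for x :: real and e
    by (cases e) auto
  have b: "x * rand_poly_deriv S a x - real m * rand_poly S a x = rand_poly S b x" for x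
  proof -
    have "x * rand_poly_deriv S a x = (\<Sum>e\<in>S. a e * (real e * x ^ e))"
      unfolding rand_poly_deriv_def sum_distrib_left by (simp add: pw[symmetric] ac_simps)
    then show ?thesis
      by (simp add: rand_poly_def b_def sum_distrib_left sum_subtractf[symmetric] algebra_simps)
  qed
  have crit: "w = - rand_poly S a x / x ^ m \<and> rand_poly S b x = 0"
    if "x > 0" "rand_poly (insert m S) (a(m := w)) x = 0"
      "rand_poly_deriv (insert m S) (a(m := w)) x = 0" for w x
  proof
    have 1: "rand_poly S a x = - (w * x ^ m)" using that(2) by (simp add: ins)
    then show "w = - rand_poly S a x / x ^ m" using that(1) by simp
    have 2: "rand_poly_deriv S a x = - (w * (real m * x ^ (m - 1)))"
      using that(3) by (simp add: ins)
    have "x * rand_poly_deriv S a x = - (w * (x * (real m * x ^ (m - 1))))"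
      unfolding 2 by simp
    then show "rand_poly S b x = 0" unfolding b[symmetric] 1 pw by simp
  qed
  show ?thesis
  proof (cases "\<exists>e\<in>S. a e \<noteq> 0")
    case True
    then obtain e where "e \<in> S" "b e \<noteq> 0" using S(2) by (auto simp: b_def)
    then have "finite ((\<lambda>x. - rand_poly S a x / x ^ m) ` {x. rand_poly S b x = 0})"
      using S(1) by (intro finite_imageI finite_zeros_rand_poly)
    then show ?thesis by (rule rev_finite_subset) (use crit in blast)
  next
    \<comment> \<open>Here every point is critical, but the only critical value is 0.\<close>
    case False
    then have "rand_poly S a x = 0" for x by (simp add: rand_poly_def)
    then have "?W \<subseteq> {0}" using crit by fastforce
    then show ?thesis by (rule finite_subset) simp
  qed
qed

lemma rand_poly_measurable [measurable]:
  "(\<lambda>a. rand_poly S a x) \<in> borel_measurable (coeff_measure S)"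
  "(\<lambda>a. rand_poly_deriv S a x) \<in> borel_measurable (coeff_measure S)"
  unfolding rand_poly_def rand_poly_deriv_def coeff_measure_def by measurable

text \<open>By compactness a double zero in \<open>[r, 1 - r]\<close> exists iff \<open>\<bar>f\<bar> + \<bar>f'\<bar>\<close> is arbitrarily small at
  rational points there, which makes the event measurable.\<close>
lemma AE_no_double_zero:
  assumes "finite S" "S \<noteq> {}"
  shows "AE a in coeff_measure S. \<forall>x\<in>{0<..<1}. rand_poly S a x = 0 \<longrightarrow> rand_poly_deriv S a x \<noteq> 0"
proof -
  define g where "g a x = \<bar>rand_poly S a x\<bar> + \<bar>rand_poly_deriv S a x\<bar>" for a x
  have cont: "continuous_on X (g a)" for X a
    unfolding g_def by (intro continuous_intros continuous_on_rand_poly continuous_on_rand_poly_deriv)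
  define T where "T j = {a \<in> space (coeff_measure S). \<forall>i::nat. \<exists>q::rat.
    1 / real (Suc j) < of_rat q \<and> of_rat q < 1 - 1 / real (Suc j) \<and> g a (of_rat q) < 1 / real (Suc i)}" for j
  have T [measurable]: "T j \<in> sets (coeff_measure S)" for j
    unfolding T_def g_def by measurable
  have T_dbl: "\<exists>x>0. rand_poly S a x = 0 \<and> rand_poly_deriv S a x = 0" if "a \<in> T j" for a j
  proof -
    define r where "r = 1 / real (Suc j)"
    have "\<forall>i. \<exists>x. r < x \<and> x < 1 - r \<and> g a x < 1 / real (Suc i)"
      using that unfolding T_def r_def by blast
    then have small: "\<exists>x\<in>{r..1 - r}. g a x < 1 / real (Suc i)" for i
      by (meson atLeastAtMost_iff less_imp_le)
    then have "{r..1 - r} \<noteq> {}" by blast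
    then obtain x where x: "x \<in> {r..1 - r}" "\<And>y. y \<in> {r..1 - r} \<Longrightarrow> g a x \<le> g a y"
      using continuous_attains_inf[OF compact_Icc _ cont] by blast
    have "g a x \<le> 0"
    proof (rule ccontr)
      assume "\<not> g a x \<le> 0"
      then obtain i where "1 / real (Suc i) < g a x"
        using nat_approx_posE[of "g a x"] by (auto simp: not_le)
      then show False using small[of i] x(2) by fastforce
    qed
    then have "rand_poly S a x = 0 \<and> rand_poly_deriv S a x = 0"
      unfolding g_def by (smt (verit) abs_ge_zero)
    moreover have "x > 0" using x(1) by (auto simp: r_def intro: less_le_trans[rotated])
    ultimately show ?thesis by blast
  qed
  have null: "T j \<in> null_sets (coeff_measure S)" for j
  proof -
    \<comment> \<open>One coefficient is singled out and integrated first. With the others fixed,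
      only finitely many of its values allow a double zero.\<close>
    obtain m where m: "m \<in> S" using assms by blast
    define S' where "S' = S - {m}"
    have S': "finite S'" "m \<notin> S'" "S = insert m S'" using m assms by (auto simp: S'_def)
    interpret product_sigma_finite "\<lambda>_ :: nat. std_normal" ..
    have meas: "indicator (T j) \<in> borel_measurable (\<Pi>\<^sub>M e\<in>insert m S'. std_normal)"
      using T[of j] unfolding coeff_measure_def S'(3)[symmetric] by (rule borel_measurable_indicator)
    have "emeasure (coeff_measure S) (T j) = (\<integral>\<^sup>+a. indicator (T j) a \<partial>coeff_measure S)" by simp
    also have "\<dots> = (\<integral>\<^sup>+a. \<integral>\<^sup>+w. indicator (T j) (a(m := w)) \<partial>std_normal \<partial>(\<Pi>\<^sub>M e\<in>S'. std_normal))"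
      using product_nn_integral_insert[OF S'(1,2) meas]
      unfolding coeff_measure_def S'(3)[symmetric] .
    also have "\<dots> = (\<integral>\<^sup>+a. 0 \<partial>(\<Pi>\<^sub>M e\<in>S'. std_normal))"
    proof (rule nn_integral_cong)
      fix a :: "nat \<Rightarrow> real"
      let ?W = "{w. \<exists>x>0. rand_poly S (a(m := w)) x = 0 \<and> rand_poly_deriv S (a(m := w)) x = 0}"
      have "finite ?W" using finite_double_zero_coeffs[OF S'(1,2)] unfolding S'(3) .
      then have "AE w in lborel. w \<notin> ?W"
        by (intro AE_not_in finite_imp_null_set_lborel)
      then have "AE w in std_normal. w \<notin> ?W"
        by (subst AE_density) auto
      then have "AE w in std_normal. indicator (T j) (a(m := w)) = (0 :: ennreal)"
        by eventually_elim (use T_dbl in \<open>auto simp: indicator_def\<close>)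
      then have "(\<integral>\<^sup>+w. indicator (T j) (a(m := w)) \<partial>std_normal) = (\<integral>\<^sup>+w. 0 \<partial>std_normal)"
        by (rule nn_integral_cong_AE)
      then show "(\<integral>\<^sup>+w. indicator (T j) (a(m := w)) \<partial>std_normal) = 0" by simp
    qed
    finally show ?thesis using T[of j] by (intro null_setsI) simp_all
  qed
  have "AE a in coeff_measure S. \<forall>j. a \<notin> T j"
    unfolding AE_all_countable using null by (blast intro: AE_not_in)
  with AE_space show ?thesis
  proof eventually_elim
    case (elim a)
    show ?case
    proof (intro ballI impI notI)
      fix x :: real assume x: "x \<in> {0<..<1}" and f: "rand_poly S a x = 0" "rand_poly_deriv S a x = 0"
      obtain j where j: "1 / real (Suc j) < min x (1 - x)"
        using nat_approx_posE[of "min x (1 - x)"] x by auto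
      define r where "r = 1 / real (Suc j)"
      have xr: "r < x" "x < 1 - r" using j by (auto simp: r_def)
      have "\<exists>q::rat. r < of_rat q \<and> of_rat q < 1 - r \<and> g a (of_rat q) < 1 / real (Suc i)" for i
      proof -
        have "g a x = 0" using f by (simp add: g_def)
        moreover have "isCont (g a) x" using cont[of UNIV a] by (simp add: continuous_on_eq_continuous_at)
        ultimately have "(g a \<longlongrightarrow> 0) (at x)" by (simp add: isCont_def)
        then have "\<forall>\<^sub>F y in at x. g a y < 1 / real (Suc i)" by (rule order_tendstoD) simp
        then obtain \<delta> where \<delta>: "\<delta> > 0" "\<And>y. y \<noteq> x \<Longrightarrow> dist y x < \<delta> \<Longrightarrow> g a y < 1 / real (Suc i)"
          unfolding eventually_at by auto
        obtain q where q: "x < of_rat q" "of_rat q < min (x + \<delta>) (1 - r)"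
          using of_rat_dense[of x "min (x + \<delta>) (1 - r)"] \<delta>(1) xr by auto
        then show ?thesis using xr \<delta>(2)[of "of_rat q"] by (intro exI[of _ q]) (auto simp: dist_real_def)
      qed
      then have "a \<in> T j" using elim(1) unfolding T_def r_def by blast
      then show False using elim(2) by blast
    qed
  qed
qed

section \<open>From angle sums to expected zeros\<close>

text \<open>Fatou's lemma passes from the almost sure bound by the limit inferior of the sign change
  counts to expectations, which are bounded uniformly in \<open>n\<close>.\<close>

lemma z_le_if_sum_angle_le:
  assumes S: "finite S" "S \<noteq> {}"
    and M: "\<And>n. (\<Sum>i<n. angle S (grid n i) (grid n (Suc i))) \<le> M"
  shows "z S \<le> ennreal (M / pi)"
proof -
  define N :: "nat \<Rightarrow> (nat \<Rightarrow> real) \<Rightarrow> ennreal" where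
    "N n a = (\<Sum>i<n. indicator sign_change (rand_poly S a (grid n i), rand_poly S a (grid n (Suc i))))" for n a
  have N_measurable [measurable]: "N n \<in> borel_measurable (coeff_measure S)" for n
    unfolding N_def by measurable
  have N_card: "N n a = of_nat (card {i. i < n \<and>
      (rand_poly S a (grid n i) > 0) \<noteq> (rand_poly S a (grid n (Suc i)) > 0)})" for n a
  proof -
    have "N n a = (\<Sum>i<n. if i \<in> {i. (rand_poly S a (grid n i) > 0) \<noteq> (rand_poly S a (grid n (Suc i)) > 0)}
        then 1 else 0)"
      unfolding N_def by (intro sum.cong) (auto simp: sign_change_def indicator_def)
    also have "\<dots> = of_nat (card ({..<n} \<inter>
        {i. (rand_poly S a (grid n i) > 0) \<noteq> (rand_poly S a (grid n (Suc i)) > 0)}))"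
      by (subst sum.inter_restrict[symmetric]) simp_all
    finally show ?thesis by (simp add: Int_def lessThan_def)
  qed
  have "AE a in coeff_measure S. of_nat (num_zeros S {0<..<1} a) \<le> liminf (\<lambda>n. N n a)"
    using AE_no_double_zero[OF S]
  proof eventually_elim
    case (elim a)
    show ?case
    proof (cases "finite {x \<in> {0<..<1}. rand_poly S a x = 0}")
      case True
      then have "\<forall>\<^sub>F n in sequentially. num_zeros S {0<..<1} a \<le>
          card {i. i < n \<and> (rand_poly S a (grid n i) > 0) \<noteq> (rand_poly S a (grid n (Suc i)) > 0)}"
        unfolding num_zeros_def using elim
        by (intro eventually_card_zeros_le_grid_sign_changes[OF _ has_real_derivative_rand_poly]) auto
      then have "\<forall>\<^sub>F n in sequentially. of_nat (num_zeros S {0<..<1} a) \<le> N n a"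
        by eventually_elim (simp add: N_card)
      then show ?thesis by (rule Liminf_bounded)
    next
      \<comment> \<open>For an infinite zero set \<open>card\<close> returns 0, and the bound is
        trivial.\<close>
      case False
      then show ?thesis by (simp add: num_zeros_def)
    qed
  qed
  then have "z S \<le> (\<integral>\<^sup>+a. liminf (\<lambda>n. N n a) \<partial>coeff_measure S)"
    unfolding z_def expected_zeros_def by (rule nn_integral_mono_AE)
  also have "\<dots> \<le> liminf (\<lambda>n. \<integral>\<^sup>+a. N n a \<partial>coeff_measure S)"
    by (rule nn_integral_liminf) measurable
  also have "\<dots> \<le> liminf (\<lambda>n. ennreal (M / pi))"
  proof (intro Liminf_mono always_eventually allI)
    fix n
    have "(\<integral>\<^sup>+a. N n a \<partial>coeff_measure S) = (\<Sum>i<n. \<integral>\<^sup>+a.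
        indicator sign_change (rand_poly S a (grid n i), rand_poly S a (grid n (Suc i))) \<partial>coeff_measure S)"
      unfolding N_def by (rule nn_integral_sum) measurable
    also have "\<dots> \<le> (\<Sum>i<n. ennreal (angle S (grid n i) (grid n (Suc i)) / pi))"
      using S by (intro sum_mono nn_integral_sign_change_le grid_pos)
    also have "\<dots> = ennreal ((\<Sum>i<n. angle S (grid n i) (grid n (Suc i))) / pi)"
      unfolding sum_divide_distrib using S
      by (intro sum_ennreal divide_nonneg_pos angle_bounds(1) grid_pos) auto
    also have "\<dots> \<le> ennreal (M / pi)"
      using M by (intro ennreal_leI divide_right_mono) auto
    finally show "(\<integral>\<^sup>+a. N n a \<partial>coeff_measure S) \<le> ennreal (M / pi)" .
  qed
  also have "\<dots> = ennreal (M / pi)" by (simp add: Liminf_const)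
  finally show ?thesis .
qed

theorem theorem1p1:
  fixes S :: "nat set" and k :: nat
  assumes "finite S" and "card S = k" and "k \<ge> 1"
  shows "z S \<le> ennreal (2 / pi * sqrt (real k - 1)) \<and>
         (k \<ge> 2 \<longrightarrow>
           z S \<le> ennreal (1 / 4 + 2 / pi * (sqrt (real k - 1) - 1)) \<and>
           1 / 4 + 2 / pi * (sqrt (real k - 1) - 1) \<le> 2 / pi * sqrt (real k - 1))"
proof (cases "k \<ge> 2")
  case True
  have ne: "S \<noteq> {}" using assms by auto
  have "z S \<le> ennreal ((pi / 4 + 2 * (sqrt (real k - 1) - 1)) / pi)"
    by (rule z_le_if_sum_angle_le[OF assms(1) ne])
      (rule sum_angle_le[OF assms(1,2) True grid_pos grid_mono], simp add: grid_self)
  also have "(pi / 4 + 2 * (sqrt (real k - 1) - 1)) / pi = 1 / 4 + 2 / pi * (sqrt (real k - 1) - 1)"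
    by (simp add: add_divide_distrib)
  finally have z: "z S \<le> ennreal (1 / 4 + 2 / pi * (sqrt (real k - 1) - 1))" .
  have "1 / 4 \<le> 2 / pi" using pi_less_4 by (simp add: field_simps)
  then have le: "1 / 4 + 2 / pi * (sqrt (real k - 1) - 1) \<le> 2 / pi * sqrt (real k - 1)"
    by (simp add: right_diff_distrib)
  show ?thesis using z le order_trans[OF z ennreal_leI[OF le]] by blast
next
  case False
  with assms(3) have k: "k = 1" by simp
  then obtain m where S: "S = {m}" using assms(2) by (auto simp: card_1_singleton_iff)
  \<comment> \<open>All moment vectors over a singleton are parallel, so every angle sum is
    0.\<close>
  have "z S \<le> ennreal (0 / pi)"
    by (rule z_le_if_sum_angle_le) (simp_all add: S angle_singleton grid_pos)
  then show ?thesis using k by simp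
qed

end
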